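(* There exist a compact non-degenerate interval $X\subset\mathbb R$ and a $C^3$ map $f\colon X\to X$ having exactly two critical points, both non-degenerate, for which the level-2 Large Deviation Principle does not hold.
   Context: A critical point $c$ of $f$ is non-degenerate if $f''(c)\neq0$. $\mathcal M$ is the space of Borel probability measures on $X$ with the weak* topology; $\delta_x^n=\frac1n\sum_{k=0}^{n-1}\delta_{f^k(x)}\in\mathcal M$, where $\delta_y$ is the unit point mass at $y$; $|A|$ is the Lebesgue measure of a Borel set $A\subset X$. The level-2 Large Deviation Principle holds for $f$ if there exists a convex lower semicontinuous function $I\colon\mathcal M\to[0,\infty]$ such that $\liminf_{n\to\infty}\frac{1}{n}\log|\{x\in X\colon\delta_x^n\in\mathcal G\}|\geq-\inf_{\mathcal G} I$ for any open set $\mathcal G\subset\mathcal M$, and $\limsup_{n\to\infty}\frac{1}{n}\log|\{x\in X\colon\delta_x^n\in\mathcal C\}|\leq-\inf_{\mathcal C} I$ for any closed set $\mathcal C\subset\mathcal M$. Conventions: $\inf\emptyset=\infty$, $\log 0=-\infty$. *)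

theory Defs
  imports "HOL-Probability.Probability"
begin

text \<open>The derivative relative to \<open>X\<close>; it is one-sided at the endpoints of an interval.\<close>

definition deriv_on :: "real set \<Rightarrow> (real \<Rightarrow> real) \<Rightarrow> real \<Rightarrow> real" where
  "deriv_on X f x = vector_derivative f (at x within X)"

fun Ck_on :: "nat \<Rightarrow> real set \<Rightarrow> (real \<Rightarrow> real) \<Rightarrow> bool" where
  "Ck_on 0 X f \<longleftrightarrow> continuous_on X f"
| "Ck_on (Suc k) X f \<longleftrightarrow> f differentiable_on X \<and> Ck_on k X (deriv_on X f)"

definition critical_points :: "real set \<Rightarrow> (real \<Rightarrow> real) \<Rightarrow> real set" where
  "critical_points X f = {c \<in> X. deriv_on X f c = 0}"

definition nondegenerate :: "real set \<Rightarrow> (real \<Rightarrow> real) \<Rightarrow> real \<Rightarrow> bool" where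
  "nondegenerate X f c \<longleftrightarrow> deriv_on X (deriv_on X f) c \<noteq> 0"

definition prob_measures :: "real set \<Rightarrow> real measure set" where
  "prob_measures X = {\<mu>. sets \<mu> = sets (restrict_space borel X) \<and> prob_space \<mu>}"

text \<open>The coarsest topology making \<open>\<mu> \<mapsto> \<integral>\<phi> d\<mu>\<close> continuous for all continuous \<open>\<phi>\<close>;
  it is meant for compact \<open>X\<close>, where such \<open>\<phi>\<close> are bounded.\<close>

definition weak_star :: "real set \<Rightarrow> real measure topology" where
  "weak_star X = topology_generated_by
     {{\<mu> \<in> prob_measures X. (\<integral>x. \<phi> x \<partial>\<mu>) \<in> U} | \<phi> (U :: real set). continuous_on X \<phi> \<and> open U}"

lemma topspace_weak_star: "topspace (weak_star X) = prob_measures X"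
proof -
  have "prob_measures X \<in>
      {{\<mu> \<in> prob_measures X. (\<integral>x. \<phi> x \<partial>\<mu>) \<in> U} | \<phi> (U :: real set). continuous_on X \<phi> \<and> open U}"
    by (rule CollectI, rule exI[of _ "\<lambda>_. 0"], rule exI[of _ UNIV]) auto
  then show ?thesis
    unfolding weak_star_def topology_generated_by_topspace by blast
qed

definition convex_comb :: "real \<Rightarrow> real measure \<Rightarrow> real measure \<Rightarrow> real measure" where
  "convex_comb t \<mu> \<nu> = measure_of (space \<mu>) (sets \<mu>)
     (\<lambda>A. ennreal t * emeasure \<mu> A + ennreal (1 - t) * emeasure \<nu> A)"

lemma emeasure_convex_comb:
  assumes "sets \<nu> = sets \<mu>" "A \<in> sets \<mu>"
  shows "emeasure (convex_comb t \<mu> \<nu>) A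
    = ennreal t * emeasure \<mu> A + ennreal (1 - t) * emeasure \<nu> A"
  unfolding convex_comb_def
proof (rule emeasure_measure_of_sigma)
  show "countably_additive (sets \<mu>)
      (\<lambda>A. ennreal t * emeasure \<mu> A + ennreal (1 - t) * emeasure \<nu> A)"
  proof (rule countably_additiveI)
    fix B :: "nat \<Rightarrow> real set"
    assume B: "range B \<subseteq> sets \<mu>" "disjoint_family B"
    have "(\<Sum>i. emeasure \<mu> (B i)) = emeasure \<mu> (\<Union>i. B i)"
      "(\<Sum>i. emeasure \<nu> (B i)) = emeasure \<nu> (\<Union>i. B i)"
      using B assms(1) by (auto intro!: suminf_emeasure)
    then show "(\<Sum>i. ennreal t * emeasure \<mu> (B i) + ennreal (1 - t) * emeasure \<nu> (B i))
        = ennreal t * emeasure \<mu> (\<Union>i. B i) + ennreal (1 - t) * emeasure \<nu> (\<Union>i. B i)"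
      by (simp add: suminf_add[symmetric] summableI)
  qed
qed (auto simp: assms positive_def sets.sigma_algebra_axioms)

text \<open>The measure \<open>\<delta>\<^sub>x\<^sup>n\<close>: the average of the point masses at \<open>x, f x, \<dots>, f\<^sup>n\<^sup>-\<^sup>1 x\<close>.
  It is only meaningful for \<open>n > 0\<close>.\<close>

definition empirical_measure :: "real set \<Rightarrow> (real \<Rightarrow> real) \<Rightarrow> nat \<Rightarrow> real \<Rightarrow> real measure" where
  "empirical_measure X f n x = measure_of X (sets (restrict_space borel X))
     (\<lambda>A. ennreal (1 / real n) * (\<Sum>k<n. emeasure (return (restrict_space borel X) ((f ^^ k) x)) A))"

lemma emeasure_empirical_measure:
  assumes "A \<in> sets (restrict_space borel X)"
  shows "emeasure (empirical_measure X f n x) A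
    = ennreal (1 / real n) * (\<Sum>k<n. indicator A ((f ^^ k) x))"
proof -
  let ?R = "restrict_space borel X" and ?d = "\<lambda>k. return (restrict_space borel X) ((f ^^ k) x)"
  have sp: "space ?R = X" by (simp add: space_restrict_space)
  have "emeasure (empirical_measure X f n x) A
      = ennreal (1 / real n) * (\<Sum>k<n. emeasure (?d k) A)"
    unfolding empirical_measure_def
  proof (rule emeasure_measure_of_sigma)
    show "sigma_algebra X (sets ?R)" using sets.sigma_algebra_axioms[of ?R] sp by simp
    show "countably_additive (sets ?R)
        (\<lambda>A. ennreal (1 / real n) * (\<Sum>k<n. emeasure (?d k) A))"
    proof (rule countably_additiveI)
      fix B :: "nat \<Rightarrow> real set"
      assume B: "range B \<subseteq> sets ?R" "disjoint_family B"
      have "(\<Sum>i. emeasure (?d k) (B i)) = emeasure (?d k) (\<Union>i. B i)" for k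
        using B by (intro suminf_emeasure) auto
      then show "(\<Sum>i. ennreal (1 / real n) * (\<Sum>k<n. emeasure (?d k) (B i)))
          = ennreal (1 / real n) * (\<Sum>k<n. emeasure (?d k) (\<Union>i. B i))"
        by (simp add: suminf_sum summableI del: emeasure_return)
    qed
  qed (use assms in \<open>auto simp: positive_def\<close>)
  then show ?thesis using assms by simp
qed

definition convex_rate :: "real set \<Rightarrow> (real measure \<Rightarrow> ereal) \<Rightarrow> bool" where
  "convex_rate X I \<longleftrightarrow> (\<forall>\<mu>\<in>prob_measures X. \<forall>\<nu>\<in>prob_measures X. \<forall>t\<in>{0..1}.
     I (convex_comb t \<mu> \<nu>) \<le> ereal t * I \<mu> + ereal (1 - t) * I \<nu>)"

definition lower_semicontinuous_rate :: "real set \<Rightarrow> (real measure \<Rightarrow> ereal) \<Rightarrow> bool" where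
  "lower_semicontinuous_rate X I \<longleftrightarrow>
     (\<forall>c. openin (weak_star X) {\<mu> \<in> prob_measures X. c < I \<mu>})"

text \<open>The logarithm with the convention \<open>log 0 = -\<infinity>\<close>; only used at nonnegative arguments.\<close>

definition elog :: "real \<Rightarrow> ereal" where
  "elog m = (if m \<le> 0 then -\<infinity> else ereal (ln m))"

text \<open>For continuous \<open>f : X \<rightarrow> X\<close> and \<open>n > 0\<close> the map \<open>x \<mapsto> \<delta>\<^sub>x\<^sup>n\<close> is continuous, so the set
  being measured is Borel whenever \<open>X\<close> is compact and \<open>A\<close> is weak* open or closed.\<close>

definition deviation_rate ::
    "real set \<Rightarrow> (real \<Rightarrow> real) \<Rightarrow> real measure set \<Rightarrow> nat \<Rightarrow> ereal" where
  "deviation_rate X f A n =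
     ereal (1 / real n) * elog (measure lborel {x \<in> X. empirical_measure X f n x \<in> A})"

text \<open>The infimum of the empty set is \<open>\<infinity>\<close> in \<^typ>\<open>ereal\<close>.\<close>

definition level2_LDP :: "real set \<Rightarrow> (real \<Rightarrow> real) \<Rightarrow> bool" where
  "level2_LDP X f \<longleftrightarrow> (\<exists>I :: real measure \<Rightarrow> ereal.
     (\<forall>\<mu>\<in>prob_measures X. 0 \<le> I \<mu>) \<and> convex_rate X I \<and> lower_semicontinuous_rate X I \<and>
     (\<forall>G. openin (weak_star X) G \<longrightarrow>
        liminf (deviation_rate X f G) \<ge> - (INF \<mu>\<in>G. I \<mu>)) \<and>
     (\<forall>C. closedin (weak_star X) C \<longrightarrow>
        limsup (deviation_rate X f C) \<le> - (INF \<mu>\<in>C. I \<mu>)))"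

end

theory Submission
  imports Defs
begin

text \<open>The cubic \<open>x \<mapsto> (3 x - x\<^sup>3) / 2\<close> on \<open>[-3/2, 3/2]\<close> has the two attracting fixed points \<open>1\<close> and
  \<open>-1\<close> (its critical points), and every orbit stays on one side of the repelling fixed point \<open>0\<close>.
  The upper bound forces a finite rate at some measure with much mass near \<open>1\<close>, and likewise
  near \<open>-1\<close>. By convexity the midpoint of these two measures has finite rate. But the measures
  with mass on both sides of \<open>0\<close> form an open set that contains no empirical measure, so the
  lower bound makes the rate infinite there.\<close>

section \<open>Derivatives relative to a closed interval\<close>

lemma deriv_on_eq:
  assumes "a < b" "x \<in> {a..b}" "(f has_real_derivative d) (at x within {a..b})"
  shows "deriv_on {a..b} f x = d"
  using assms unfolding deriv_on_def
  by (intro vector_derivative_within_closed_interval)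
    (auto simp: has_real_derivative_iff_has_vector_derivative)

text \<open>A derivative within \<open>X\<close> at a point of \<open>X\<close> sees only the values
  on \<open>X\<close>. This is needed because \<open>deriv_on X f\<close> is known to agree with an
  explicit formula on \<open>X\<close> alone.\<close>

lemma Ck_on_cong:
  assumes "\<And>x. x \<in> X \<Longrightarrow> f x = g x"
  shows "Ck_on k X f \<longleftrightarrow> Ck_on k X g"
  using assms
proof (induction k arbitrary: f g)
  case 0
  then show ?case by (simp cong: continuous_on_cong)
next
  case (Suc k)
  have "deriv_on X f x = deriv_on X g x" if "x \<in> X" for x
  proof -
    have "(f has_vector_derivative d) (at x within X) \<longleftrightarrow> (g has_vector_derivative d) (at x within X)" for d
      using Suc.prems that has_vector_derivative_transform[of x X f g d]
        has_vector_derivative_transform[of x X g f d] by metis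
    then show ?thesis by (simp add: deriv_on_def vector_derivative_def)
  qed
  moreover have "f differentiable_on X \<longleftrightarrow> g differentiable_on X"
    using Suc.prems differentiable_transform_within[of _ _ X 1] unfolding differentiable_on_def
    by (metis zero_less_one)
  ultimately show ?case using Suc.IH[of "deriv_on X f" "deriv_on X g"] by simp
qed

text \<open>Replaces the \<open>deriv_on\<close> in the recursion of \<open>Ck_on\<close> by an
  explicit derivative, so that smoothness can be checked one formula at a time.\<close>

lemma Ck_on_SucI:
  assumes "a < b" "\<And>x. x \<in> {a..b} \<Longrightarrow> (f has_real_derivative f' x) (at x within {a..b})"
    and "Ck_on k {a..b} f'"
  shows "Ck_on (Suc k) {a..b} f"
proof -
  have "Ck_on k {a..b} (deriv_on {a..b} f)"
    using assms Ck_on_cong[of "{a..b}" "deriv_on {a..b} f" f'] deriv_on_eq by blast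
  moreover have "f differentiable_on {a..b}"
    using assms(2) unfolding differentiable_on_def differentiable_def has_field_derivative_def by blast
  ultimately show ?thesis by simp
qed

section \<open>Probability measures on \<open>X\<close>, integrals and convex combinations\<close>

lemma space_prob_measures: "\<mu> \<in> prob_measures X \<Longrightarrow> space \<mu> = X"
  by (auto simp: prob_measures_def space_restrict_space dest: sets_eq_imp_space_eq)

lemma continuous_on_measurable_prob_measures:
  assumes "\<mu> \<in> prob_measures X" "continuous_on X (\<phi> :: real \<Rightarrow> real)"
  shows "\<phi> \<in> borel_measurable \<mu>"
proof -
  have "sets \<mu> = sets (restrict_space borel X)"
    using assms(1) by (simp add: prob_measures_def)
  then have "borel_measurable \<mu> = borel_measurable (restrict_space borel X)"
    by (rule measurable_cong_sets) simp
  then show ?thesis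
    using borel_measurable_continuous_on_restrict[OF assms(2)] by blast
qed

lemma integrable_prob_measures:
  assumes "\<mu> \<in> prob_measures X" "compact X" "continuous_on X (\<phi> :: real \<Rightarrow> real)"
  shows "integrable \<mu> \<phi>"
proof -
  interpret prob_space \<mu> using assms(1) by (simp add: prob_measures_def)
  have "bounded (\<phi> ` X)"
    using assms by (intro compact_imp_bounded compact_continuous_image)
  then obtain B where "\<And>x. x \<in> X \<Longrightarrow> norm (\<phi> x) \<le> B"
    unfolding bounded_iff by auto
  then show ?thesis
    using continuous_on_measurable_prob_measures[OF assms(1,3)] space_prob_measures[OF assms(1)]
    by (intro integrable_const_bound[of _ B]) auto
qed

lemma convex_comb_in_prob_measures:
  assumes "\<mu> \<in> prob_measures X" "\<nu> \<in> prob_measures X" "t \<in> {0..1}"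
  shows "convex_comb t \<mu> \<nu> \<in> prob_measures X"
proof -
  have s: "sets \<nu> = sets \<mu>" using assms by (simp add: prob_measures_def)
  have "emeasure (convex_comb t \<mu> \<nu>) X = ennreal t * emeasure \<mu> X + ennreal (1 - t) * emeasure \<nu> X"
    using space_prob_measures[OF assms(1)] by (intro emeasure_convex_comb[OF s]) auto
  also have "\<dots> = ennreal t + ennreal (1 - t)"
    using assms space_prob_measures[OF assms(1)] space_prob_measures[OF assms(2)]
      prob_space.emeasure_space_1[of \<mu>] prob_space.emeasure_space_1[of \<nu>]
    by (simp add: prob_measures_def)
  also have "\<dots> = 1" using assms(3) by (simp flip: ennreal_plus)
  finally have "emeasure (convex_comb t \<mu> \<nu>) X = 1" .
  moreover have "space (convex_comb t \<mu> \<nu>) = X"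
    unfolding convex_comb_def using space_prob_measures[OF assms(1)] sets.space_closed[of \<mu>]
    by (simp add: space_measure_of)
  ultimately have "prob_space (convex_comb t \<mu> \<nu>)" by (intro prob_spaceI) simp
  moreover have "sets (convex_comb t \<mu> \<nu>) = sets \<mu>" by (simp add: convex_comb_def)
  ultimately show ?thesis using assms(1) by (simp add: prob_measures_def)
qed

text \<open>The combination dominates \<open>t\<close> times \<open>\<mu>\<close>, and integrals of
  nonnegative functions are monotone in the measure. A lower bound suffices, since it serves only to
  show that an integral is positive.\<close>

lemma integral_convex_comb_ge:
  assumes "\<mu> \<in> prob_measures X" "\<nu> \<in> prob_measures X" "t \<in> {0..1}" "compact X"
    and "continuous_on X (\<phi> :: real \<Rightarrow> real)" "\<And>x. x \<in> X \<Longrightarrow> 0 \<le> \<phi> x"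
  shows "t * (\<integral>x. \<phi> x \<partial>\<mu>) \<le> (\<integral>x. \<phi> x \<partial>convex_comb t \<mu> \<nu>)"
proof -
  let ?c = "convex_comb t \<mu> \<nu>"
  have c: "?c \<in> prob_measures X" using assms by (intro convex_comb_in_prob_measures)
  have s: "sets \<nu> = sets \<mu>" "sets ?c = sets \<mu>"
    using assms(1,2) c by (auto simp: prob_measures_def)
  have nn: "(\<integral>\<^sup>+x. ennreal (\<phi> x) \<partial>m) = ennreal (\<integral>x. \<phi> x \<partial>m)" "0 \<le> (\<integral>x. \<phi> x \<partial>m)"
    if "m \<in> prob_measures X" for m
    using integrable_prob_measures[OF that assms(4,5)] space_prob_measures[OF that] assms(6)
    by (auto intro!: nn_integral_eq_integral integral_nonneg_AE AE_I2)
  \<comment> \<open>With equal sigma-algebras the order on measures is setwise comparison, and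
    dropping the \<open>\<nu>\<close> term can only decrease the value. On non-measurable sets both
    sides are 0.\<close>
  have "scale_measure (ennreal t) \<mu> \<le> ?c"
    using s emeasure_convex_comb[OF s(1)] by (auto simp: le_measure le_fun_def emeasure_notin_sets)
  then have "(\<integral>\<^sup>+x. ennreal (\<phi> x) \<partial>scale_measure (ennreal t) \<mu>) \<le> (\<integral>\<^sup>+x. ennreal (\<phi> x) \<partial>?c)"
    using s by (intro nn_integral_mono_measure) auto
  moreover have "(\<integral>\<^sup>+x. ennreal (\<phi> x) \<partial>scale_measure (ennreal t) \<mu>) = ennreal t * (\<integral>\<^sup>+x. ennreal (\<phi> x) \<partial>\<mu>)"
    using continuous_on_measurable_prob_measures[OF assms(1,5)]
    by (intro nn_integral_scale_measure) measurable
  ultimately have "ennreal (t * (\<integral>x. \<phi> x \<partial>\<mu>)) \<le> ennreal (\<integral>x. \<phi> x \<partial>?c)"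
    using nn[OF assms(1)] nn[OF c] assms(3) by (simp add: ennreal_mult)
  then show ?thesis using nn[OF c] by (simp add: ennreal_le_iff)
qed

text \<open>Carries the bound of \<open>integral_convex_comb_ge\<close> over to the second
  component.\<close>

lemma convex_comb_commute:
  assumes "sets \<mu> = sets \<nu>"
  shows "convex_comb t \<mu> \<nu> = convex_comb (1 - t) \<nu> \<mu>"
  using assms sets_eq_imp_space_eq[OF assms] unfolding convex_comb_def by (simp add: add.commute)

section \<open>Weak* open and closed sets given by one integral\<close>

lemma openin_integral_in:
  assumes "continuous_on X (\<phi> :: real \<Rightarrow> real)" "open (U :: real set)"
  shows "openin (weak_star X) {\<mu> \<in> prob_measures X. (\<integral>x. \<phi> x \<partial>\<mu>) \<in> U}"
  unfolding weak_star_def using assms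
  by (intro topology_generated_by_Basis CollectI exI[of _ \<phi>] exI[of _ U]) auto

lemma closedin_integral_ge:
  assumes "continuous_on X (\<phi> :: real \<Rightarrow> real)"
  shows "closedin (weak_star X) {\<mu> \<in> prob_measures X. c \<le> (\<integral>x. \<phi> x \<partial>\<mu>)}"
proof -
  have "openin (weak_star X) {\<mu> \<in> prob_measures X. (\<integral>x. \<phi> x \<partial>\<mu>) \<in> {..<c}}"
    using assms by (intro openin_integral_in) auto
  moreover have "prob_measures X - {\<mu> \<in> prob_measures X. c \<le> (\<integral>x. \<phi> x \<partial>\<mu>)}
      = {\<mu> \<in> prob_measures X. (\<integral>x. \<phi> x \<partial>\<mu>) \<in> {..<c}}" by auto
  ultimately show ?thesis unfolding closedin_def by (auto simp: topspace_weak_star)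
qed

section \<open>Orbits and their empirical measures\<close>

lemma funpow_in:
  assumes "f ` X \<subseteq> X" "x \<in> X"
  shows "(f ^^ k) x \<in> X"
  using assms by (induction k) auto

lemma continuous_on_funpow:
  assumes "f ` X \<subseteq> X" "continuous_on X f"
  shows "continuous_on X (f ^^ k)"
proof (induction k)
  case (Suc k)
  have "(f ^^ k) ` X \<subseteq> X" using funpow_in[OF assms(1)] by auto
  then show ?case using continuous_on_compose2[OF assms(2) Suc] by (simp add: comp_def)
qed (simp add: id_def)

text \<open>Views the empirical measure as the push-forward of the uniform distribution on the times
  below \<open>n\<close>. The general facts on \<open>distr\<close> then make it a probability
  measure and turn its integrals into time averages.\<close>

lemma empirical_measure_eq_distr:
  assumes "f ` X \<subseteq> X" "x \<in> X" "n > 0"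
  shows "empirical_measure X f n x
    = distr (uniform_count_measure {..<n}) (restrict_space borel X) (\<lambda>k. (f ^^ k) x)"
proof (rule measure_eqI)
  let ?R = "restrict_space borel X" and ?u = "uniform_count_measure {..<n}"
  have "sets (empirical_measure X f n x) = sets ?R"
    using sets.sigma_algebra_axioms[of ?R]
    by (simp add: empirical_measure_def space_restrict_space sigma_algebra.sets_measure_of_eq)
  then show "sets (empirical_measure X f n x) = sets (distr ?u ?R (\<lambda>k. (f ^^ k) x))" by simp
  fix A assume "A \<in> sets (empirical_measure X f n x)"
  then have A: "A \<in> sets ?R" using \<open>sets (empirical_measure X f n x) = sets ?R\<close> by simp
  have m: "(\<lambda>k. (f ^^ k) x) \<in> measurable ?u ?R"
    using funpow_in[OF assms(1,2)]
    by (auto simp: measurable_def space_restrict_space space_uniform_count_measure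
        sets_uniform_count_measure)
  let ?K = "{k. k < n \<and> (f ^^ k) x \<in> A}"
  have "emeasure (distr ?u ?R (\<lambda>k. (f ^^ k) x)) A = emeasure ?u ?K"
    using A by (subst emeasure_distr[OF m A])
      (auto simp: space_uniform_count_measure intro!: arg_cong[of _ _ "emeasure ?u"])
  also have "\<dots> = ennreal (real (card ?K) / real n)"
    by (subst emeasure_uniform_count_measure) auto
  also have "\<dots> = ennreal (1 / real n) * of_nat (card ?K)"
    by (simp add: ennreal_of_nat_eq_real_of_nat flip: ennreal_mult)
  also have "of_nat (card ?K) = (\<Sum>k<n. indicator A ((f ^^ k) x) :: ennreal)"
    by (simp add: indicator_def sum.If_cases Int_def)
  finally show "emeasure (empirical_measure X f n x) A
      = emeasure (distr ?u ?R (\<lambda>k. (f ^^ k) x)) A"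
    using A by (simp add: emeasure_empirical_measure)
qed

lemma empirical_measure_in_prob_measures:
  assumes "f ` X \<subseteq> X" "x \<in> X" "n > 0"
  shows "empirical_measure X f n x \<in> prob_measures X"
proof -
  let ?u = "uniform_count_measure {..<n}"
  have "prob_space ?u" using assms(3) by (intro prob_space_uniform_count_measure) auto
  moreover have "(\<lambda>k. (f ^^ k) x) \<in> measurable ?u (restrict_space borel X)"
    using funpow_in[OF assms(1,2)]
    by (auto simp: measurable_def space_restrict_space space_uniform_count_measure
        sets_uniform_count_measure)
  ultimately show ?thesis
    unfolding prob_measures_def empirical_measure_eq_distr[OF assms]
    by (simp add: prob_space.prob_space_distr)
qed

lemma integral_empirical_measure:
  assumes "f ` X \<subseteq> X" "x \<in> X" "n > 0" "continuous_on X (\<phi> :: real \<Rightarrow> real)"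
  shows "(\<integral>y. \<phi> y \<partial>empirical_measure X f n x) = (\<Sum>k<n. \<phi> ((f ^^ k) x)) / real n"
proof -
  have "(\<lambda>k. (f ^^ k) x) \<in> measurable (uniform_count_measure {..<n}) (restrict_space borel X)"
    using funpow_in[OF assms(1,2)]
    by (auto simp: measurable_def space_restrict_space space_uniform_count_measure
        sets_uniform_count_measure)
  then show ?thesis
    unfolding empirical_measure_eq_distr[OF assms(1-3)]
    using borel_measurable_continuous_on_restrict[OF assms(4)]
    by (subst integral_distr) (auto simp: integral_uniform_count_measure)
qed

text \<open>A lower bound along the whole orbit passes to every time average, so \<open>A\<close>
  lies in the set on the right. That set is a superlevel set of a continuous time average, which
  settles its measurability.\<close>

lemma measure_empirical_integral_ge:
  assumes X: "compact X" "f ` X \<subseteq> X" "continuous_on X f" and "n > 0"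
    and \<phi>: "continuous_on X (\<phi> :: real \<Rightarrow> real)"
    and A: "A \<in> sets borel" "A \<subseteq> X" "\<And>x k. x \<in> A \<Longrightarrow> c \<le> \<phi> ((f ^^ k) x)"
  shows "measure lborel A \<le> measure lborel
    {x \<in> X. empirical_measure X f n x \<in> {\<mu> \<in> prob_measures X. c \<le> (\<integral>x. \<phi> x \<partial>\<mu>)}}"
proof -
  let ?s = "\<lambda>x. (\<Sum>k<n. \<phi> ((f ^^ k) x)) / real n"
  let ?E = "{x \<in> X. empirical_measure X f n x \<in> {\<mu> \<in> prob_measures X. c \<le> (\<integral>x. \<phi> x \<partial>\<mu>)}}"
  have E: "?E = X \<inter> ?s -` {c..}"
    using empirical_measure_in_prob_measures[OF X(2) _ \<open>n > 0\<close>]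
      integral_empirical_measure[OF X(2) _ \<open>n > 0\<close> \<phi>] by auto
  have "continuous_on X (\<lambda>x. \<phi> ((f ^^ k) x))" for k
    using funpow_in[OF X(2)]
    by (intro continuous_on_compose2[OF \<phi> continuous_on_funpow[OF X(2,3)]]) auto
  then have "continuous_on X ?s"
    using \<open>n > 0\<close> by (intro continuous_intros) auto
  then have "closed (X \<inter> ?s -` {c..})"
    using X(1) by (intro continuous_closed_preimage compact_imp_closed closed_atLeast)
  \<comment> \<open>Compactness makes the set Borel and of finite Lebesgue measure. Finiteness
    matters because the real-valued \<open>measure\<close> is 0 on sets of infinite measure and so
    is not monotone in general.\<close>
  then have "compact ?E"
    unfolding E using compact_Int_closed[OF X(1)] by (metis Int_left_absorb)
  moreover have "c \<le> ?s x" if "x \<in> A" for x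
    using sum_mono[of "{..<n}" "\<lambda>_. c" "\<lambda>k. \<phi> ((f ^^ k) x)"] A(3)[OF that] \<open>n > 0\<close>
    by (simp add: field_simps)
  then have "A \<subseteq> ?E" unfolding E using A(2) by auto
  moreover have "emeasure lborel ?E < \<infinity>"
    using \<open>compact ?E\<close> by (metis compact_imp_bounded emeasure_bounded_finite)
  ultimately show ?thesis
    using A(1) by (intro measure_mono_fmeasurable) (auto simp: fmeasurable_def compact_imp_closed)
qed

section \<open>Deviation rates and the obstruction to the principle\<close>

lemma limsup_deviation_rate_ge:
  assumes "0 < m" "m \<le> 1" "\<And>n. n > 0 \<Longrightarrow> m \<le> measure lborel {x \<in> X. empirical_measure X f n x \<in> C}"
  shows "ereal (ln m) \<le> limsup (deviation_rate X f C)"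
proof -
  have "ereal (ln m) \<le> deviation_rate X f C n" if "n > 0" for n
  proof -
    let ?M = "measure lborel {x \<in> X. empirical_measure X f n x \<in> C}"
    have M: "m \<le> ?M" by (rule assms(3)[OF that])
    \<comment> \<open>As \<open>m \<le> 1\<close>, its logarithm is nonpositive, and a factor of at
      most 1 can only raise it. This crude bound, uniform in \<open>n\<close>, is enough because
      only finiteness is at stake.\<close>
    have "ln m \<le> 1 / real n * ln m"
      using assms(1,2) that mult_right_mono_neg[of "1 / real n" 1 "ln m"] by simp
    also have "\<dots> \<le> 1 / real n * ln ?M"
      using M assms(1) that by (intro mult_left_mono) auto
    finally show ?thesis using M assms(1) by (simp add: deviation_rate_def elog_def)
  qed
  then have "limsup (\<lambda>_. ereal (ln m)) \<le> limsup (deviation_rate X f C)"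
    by (intro Limsup_mono eventually_sequentiallyI[of 1]) auto
  then show ?thesis by (simp add: Limsup_const)
qed

lemma liminf_deviation_rate_empty:
  assumes "\<And>n x. n > 0 \<Longrightarrow> x \<in> X \<Longrightarrow> empirical_measure X f n x \<notin> C"
  shows "liminf (deviation_rate X f C) = -\<infinity>"
proof -
  \<comment> \<open>At \<open>n = 0\<close> the factor \<open>1 / real n\<close> is 0 and so is the
    rate. This index does not affect the limit inferior.\<close>
  have "deviation_rate X f C n = -\<infinity>" if "n > 0" for n
  proof -
    have "{x \<in> X. empirical_measure X f n x \<in> C} = {}" using assms[OF that] by auto
    then show ?thesis using that by (simp only: deviation_rate_def elog_def measure_empty) simp
  qed
  then have "liminf (deviation_rate X f C) \<le> liminf (\<lambda>_. -\<infinity>)"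
    by (intro Liminf_mono eventually_sequentiallyI[of 1]) auto
  then show ?thesis by (simp add: Liminf_const)
qed

text \<open>Isolates what the argument uses of the dynamics: \<open>\<phi>\<close> and
  \<open>\<psi>\<close> detect two parts of the space that no single orbit visits both of, while
  each part traps a set of positive Lebesgue measure.\<close>

lemma not_level2_LDP:
  assumes X: "compact X" "f ` X \<subseteq> X" "continuous_on X f"
    and \<phi>: "continuous_on X (\<phi> :: real \<Rightarrow> real)" "\<And>x. x \<in> X \<Longrightarrow> 0 \<le> \<phi> x"
    and \<psi>: "continuous_on X (\<psi> :: real \<Rightarrow> real)" "\<And>x. x \<in> X \<Longrightarrow> 0 \<le> \<psi> x"
    and separated: "\<And>x. x \<in> X \<Longrightarrow> (\<forall>k. \<phi> ((f ^^ k) x) = 0) \<or> (\<forall>k. \<psi> ((f ^^ k) x) = 0)"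
    and A: "A \<in> sets borel" "A \<subseteq> X" "0 < measure lborel A" "\<And>x k. x \<in> A \<Longrightarrow> 1 \<le> \<phi> ((f ^^ k) x)"
    and B: "B \<in> sets borel" "B \<subseteq> X" "0 < measure lborel B" "\<And>x k. x \<in> B \<Longrightarrow> 1 \<le> \<psi> ((f ^^ k) x)"
  shows "\<not> level2_LDP X f"
proof
  assume "level2_LDP X f"
  then obtain I :: "real measure \<Rightarrow> ereal" where convex: "convex_rate X I"
    and upper: "\<And>C. closedin (weak_star X) C \<Longrightarrow> limsup (deviation_rate X f C) \<le> - (INF \<mu>\<in>C. I \<mu>)"
    and lower: "\<And>G. openin (weak_star X) G \<Longrightarrow> - (INF \<mu>\<in>G. I \<mu>) \<le> liminf (deviation_rate X f G)"
    unfolding level2_LDP_def by blast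
  \<comment> \<open>Stated for a general observable, to be applied to \<open>\<phi>\<close> with
    \<open>A\<close> and to \<open>\<psi>\<close> with \<open>B\<close>.\<close>
  have finite_rate: "\<exists>\<mu>\<in>prob_measures X. 1 \<le> (\<integral>x. \<theta> x \<partial>\<mu>) \<and> I \<mu> < \<infinity>"
    if \<theta>: "continuous_on X (\<theta> :: real \<Rightarrow> real)"
      and S: "S \<in> sets borel" "S \<subseteq> X" "0 < measure lborel S" "\<And>x k. x \<in> S \<Longrightarrow> 1 \<le> \<theta> ((f ^^ k) x)"
    for \<theta> S
  proof -
    let ?C = "{\<mu> \<in> prob_measures X. 1 \<le> (\<integral>x. \<theta> x \<partial>\<mu>)}"
    \<comment> \<open>The truncation at 1 makes the logarithm nonpositive, as the bound on the limit
      superior requires.\<close>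
    let ?m = "min 1 (measure lborel S)"
    have "ereal (ln ?m) \<le> limsup (deviation_rate X f ?C)"
    proof (rule limsup_deviation_rate_ge)
      show "?m \<le> measure lborel {x \<in> X. empirical_measure X f n x \<in> ?C}" if "n > 0" for n
        using measure_empirical_integral_ge[OF X that \<theta> S(1,2,4)] by simp
    qed (use S(3) in auto)
    also have "\<dots> \<le> - (INF \<mu>\<in>?C. I \<mu>)"
      by (intro upper closedin_integral_ge \<theta>)
    \<comment> \<open>An infinite infimum would put the real number \<open>ln ?m\<close> below
      \<open>-\<infinity>\<close>.\<close>
    finally have "(INF \<mu>\<in>?C. I \<mu>) \<noteq> \<infinity>" by auto
    then have "(INF \<mu>\<in>?C. I \<mu>) < \<infinity>" by simp
    then show ?thesis unfolding INF_less_iff by auto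
  qed
  obtain \<mu> where \<mu>: "\<mu> \<in> prob_measures X" "1 \<le> (\<integral>x. \<phi> x \<partial>\<mu>)" "I \<mu> < \<infinity>"
    using finite_rate[OF \<phi>(1) A] by blast
  obtain \<nu> where \<nu>: "\<nu> \<in> prob_measures X" "1 \<le> (\<integral>x. \<psi> x \<partial>\<nu>)" "I \<nu> < \<infinity>"
    using finite_rate[OF \<psi>(1) B] by blast
  let ?c = "convex_comb (1 / 2) \<mu> \<nu>"
  have "I ?c \<le> ereal (1 / 2) * I \<mu> + ereal (1 - 1 / 2) * I \<nu>"
    using convex[unfolded convex_rate_def, rule_format, OF \<mu>(1) \<nu>(1), of "1 / 2"] by simp
  also have "\<dots> < \<infinity>" using \<mu>(3) \<nu>(3) by (cases "I \<mu>"; cases "I \<nu>") auto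
  finally have finite: "I ?c < \<infinity>" .
  \<comment> \<open>The measures seen by both detectors. Along any orbit one of the two time
    averages vanishes, so no empirical measure with \<open>n > 0\<close> lies here, whereas the
    midpoint \<open>?c\<close> does.\<close>
  let ?G = "{\<mu> \<in> prob_measures X. (\<integral>x. \<phi> x \<partial>\<mu>) \<in> {0<..}} \<inter> {\<mu> \<in> prob_measures X. (\<integral>x. \<psi> x \<partial>\<mu>) \<in> {0<..}}"
  have "openin (weak_star X) ?G"
    using \<phi>(1) \<psi>(1) by (intro openin_Int openin_integral_in) auto
  then have "- (INF \<mu>\<in>?G. I \<mu>) \<le> liminf (deviation_rate X f ?G)" by (rule lower)
  also have "liminf (deviation_rate X f ?G) = -\<infinity>"
  proof (rule liminf_deviation_rate_empty)
    fix n :: nat and x assume "n > 0" "x \<in> X"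
    then show "empirical_measure X f n x \<notin> ?G"
      using separated[of x] integral_empirical_measure[OF X(2), of x n \<phi>]
        integral_empirical_measure[OF X(2), of x n \<psi>] \<phi>(1) \<psi>(1) by auto
  qed
  finally have "(INF \<mu>\<in>?G. I \<mu>) = \<infinity>" by simp
  moreover have "(INF \<mu>\<in>?G. I \<mu>) \<le> I ?c"
  proof (rule INF_lower)
    have "?c = convex_comb (1 - 1 / 2) \<nu> \<mu>"
      using \<mu>(1) \<nu>(1) by (intro convex_comb_commute) (simp add: prob_measures_def)
    then have "1 / 2 * (\<integral>x. \<psi> x \<partial>\<nu>) \<le> (\<integral>x. \<psi> x \<partial>?c)"
      using integral_convex_comb_ge[OF \<nu>(1) \<mu>(1) _ X(1) \<psi>, of "1 / 2"] by simp
    moreover have "1 / 2 * (\<integral>x. \<phi> x \<partial>\<mu>) \<le> (\<integral>x. \<phi> x \<partial>?c)"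
      using integral_convex_comb_ge[OF \<mu>(1) \<nu>(1) _ X(1) \<phi>, of "1 / 2"] by simp
    ultimately show "?c \<in> ?G"
      using \<mu>(2) \<nu>(2) convex_comb_in_prob_measures[OF \<mu>(1) \<nu>(1), of "1 / 2"] by auto
  qed
  ultimately show False using finite by simp
qed

section \<open>The cubic map with two attracting fixed points\<close>

theorem theoremB:
  shows "\<exists>(a :: real) (b :: real) (f :: real \<Rightarrow> real).
    a < b \<and> f ` {a..b} \<subseteq> {a..b} \<and> Ck_on 3 {a..b} f \<and>
    card (critical_points {a..b} f) = 2 \<and>
    (\<forall>c\<in>critical_points {a..b} f. nondegenerate {a..b} f c) \<and>
    \<not> level2_LDP {a..b} f"
proof -
  define f :: "real \<Rightarrow> real" where "f x = (3 * x - x ^ 3) / 2" for x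
  \<comment> \<open>The endpoint \<open>3 / 2\<close> lies strictly between the critical point 1 and
    the zero \<open>sqrt 3\<close> of \<open>f\<close>: both critical points are interior, and
    \<open>f\<close> stays nonnegative on the right half.\<close>
  let ?X = "{- 3 / 2 .. 3 / 2 :: real}"
  have odd: "f (- x) = - f x" for x by (simp add: f_def field_simps)
  have factored: "f x = x * (3 - x\<^sup>2) / 2" for x by (simp add: f_def power2_eq_square power3_eq_cube algebra_simps)
  have le1: "f x \<le> 1" if "0 \<le> x" for x
  proof -
    \<comment> \<open>This product equals \<open>2 * (1 - f x)\<close>; the double root reflects the
      local maximum of \<open>f\<close> at 1.\<close>
    have "0 \<le> (x - 1)\<^sup>2 * (x + 2)" using that by simp
    then show ?thesis by (simp add: f_def power2_eq_square power3_eq_cube field_simps)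
  qed
  have nonneg: "0 \<le> f x" if "0 \<le> x" "x \<le> 3 / 2" for x
  proof -
    have "x\<^sup>2 \<le> (3 / 2)\<^sup>2" using that by (intro power_mono)
    then have "x\<^sup>2 \<le> 3" by (simp add: power2_eq_square)
    then show ?thesis using that by (simp add: factored)
  qed
  have increasing: "x \<le> f x" if "0 \<le> x" "x \<le> 1" for x
  proof -
    \<comment> \<open>This product equals \<open>2 * (f x - x)\<close>.\<close>
    have "0 \<le> x * (1 - x\<^sup>2)" using that by (simp add: power_le_one)
    then show ?thesis by (simp add: f_def power2_eq_square power3_eq_cube algebra_simps)
  qed
  have orbit_right: "(f ^^ k) x \<in> {0..3 / 2}" if "x \<in> {0..3 / 2}" for x k
    using le1 nonneg that by (intro funpow_in) force+
  have orbit_basin: "(f ^^ k) x \<in> {1 / 2..1}" if "x \<in> {1 / 2..1}" for x k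
  proof (rule funpow_in[OF _ that])
    show "f ` {1 / 2..1} \<subseteq> {1 / 2..1}"
    proof
      fix y assume "y \<in> f ` {1 / 2..1}"
      then obtain x where "x \<in> {1 / 2..1}" "y = f x" by auto
      then show "y \<in> {1 / 2..1}" using le1[of x] increasing[of x] by auto
    qed
  qed
  \<comment> \<open>Transfers the orbit estimates from the right half to the left half by
    symmetry.\<close>
  have odd_pow: "(f ^^ k) (- x) = - (f ^^ k) x" for k x
    by (induction k) (auto simp: odd)
  have image: "f ` ?X \<subseteq> ?X"
  proof
    fix y assume "y \<in> f ` ?X"
    then obtain x where x: "x \<in> ?X" "y = f x" by auto
    then show "y \<in> ?X"
      using le1[of x] nonneg[of x] le1[of "- x"] nonneg[of "- x"] odd[of x] by (cases "0 \<le> x") auto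
  qed
  have cont: "continuous_on ?X f" unfolding f_def by (intro continuous_intros) auto

  define f1 f2 :: "real \<Rightarrow> real" where "f1 x = 3 * (1 - x\<^sup>2) / 2" and "f2 x = - 3 * x" for x
  have d1: "(f has_real_derivative f1 x) (at x within ?X)" for x
    unfolding f_def f1_def by (auto intro!: derivative_eq_intros simp: power2_eq_square)
  have d2: "(f1 has_real_derivative f2 x) (at x within ?X)" for x
    unfolding f1_def f2_def by (auto intro!: derivative_eq_intros)
  have d3: "(f2 has_real_derivative - 3) (at x within ?X)" for x
    unfolding f2_def by (auto intro!: derivative_eq_intros)
  have C3: "Ck_on 3 ?X f"
    unfolding numeral_3_eq_3
    by (rule Ck_on_SucI[OF _ d1], simp, rule Ck_on_SucI[OF _ d2], simp, rule Ck_on_SucI[OF _ d3]) auto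
  have df: "deriv_on ?X f x = f1 x" if "x \<in> ?X" for x
    using that d1 by (intro deriv_on_eq) auto
  have root: "f1 x = 0 \<longleftrightarrow> x = 1 \<or> x = - 1" for x
    using power2_eq_1_iff[of x] by (auto simp: f1_def)
  have "critical_points ?X f = {x \<in> ?X. x = 1 \<or> x = - 1}"
    unfolding critical_points_def by (intro Collect_cong conj_cong refl) (simp only: df root)
  also have "\<dots> = {1, - 1}" by force
  finally have crit: "critical_points ?X f = {1, - 1}" .
  have "nondegenerate ?X f c" if "c \<in> {1, - 1}" for c
  proof -
    have c: "c \<in> ?X" using that by auto
    \<comment> \<open>\<open>deriv_on ?X f\<close> is known to equal \<open>f1\<close> only on
      \<open>?X\<close>, which is enough for a derivative within \<open>?X\<close>.\<close>
    have "(deriv_on ?X f has_real_derivative f2 c) (at c within ?X)"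
      by (rule has_field_derivative_transform_within[OF d2 zero_less_one c]) (simp only: df)
    then have "deriv_on ?X (deriv_on ?X f) c = f2 c"
      using c by (intro deriv_on_eq) auto
    then show ?thesis using that by (auto simp: nondegenerate_def f2_def)
  qed
  \<comment> \<open>\<open>\<phi>\<close> vanishes on the left half, and its factor 2 lifts it to at
    least 1 on \<open>{1 / 2..1}\<close>, which \<open>f\<close> maps into itself.
    \<open>\<psi>\<close> and \<open>B\<close> are the mirror images.\<close>
  moreover have "\<not> level2_LDP ?X f"
  proof (rule not_level2_LDP[where \<phi> = "\<lambda>x. max (2 * x) 0" and \<psi> = "\<lambda>x. max (- 2 * x) 0"
        and A = "{1 / 2..1}" and B = "{- 1..- 1 / 2}"])
    fix x assume x: "x \<in> ?X"
    show "(\<forall>k. max (2 * (f ^^ k) x) 0 = 0) \<or> (\<forall>k. max (- 2 * (f ^^ k) x) 0 = 0)"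
      using x orbit_right[of x] orbit_right[of "- x"] by (cases "0 \<le> x") (auto simp: odd_pow)
  next
    fix x :: real and k assume "x \<in> {1 / 2..1}"
    then show "1 \<le> max (2 * (f ^^ k) x) 0" using orbit_basin[of x k] by auto
  next
    fix x :: real and k assume "x \<in> {- 1..- 1 / 2}"
    then show "1 \<le> max (- 2 * (f ^^ k) x) 0" using orbit_basin[of "- x" k] by (auto simp: odd_pow)
  qed (use image cont in \<open>auto intro!: continuous_intros\<close>)
  ultimately show ?thesis
    using image C3 crit by (intro exI[of _ "- 3 / 2"] exI[of _ "3 / 2"] exI[of _ f]) auto
qed

end
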